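(* Let $\boldsymbol k$ be an algebraically closed field with $\operatorname{char}\boldsymbol k\neq 2$, let $V$ be a vector space over $\boldsymbol k$ of finite dimension $n$, and let $\mathcal C\subseteq V^*\otimes V^*\otimes V$ be the subspace of tensors fixed by the involution $\ell\otimes\ell'\otimes v\mapsto \ell'\otimes\ell\otimes v$. Then there is a nonempty (dense) open subset $U\subseteq\mathcal C$ such that for every $m\in U$ the $\boldsymbol k$-algebra $\{V,m\}$ is a simple commutative algebra with trivial automorphism group.
   Context: For $m=\sum\ell\otimes\ell'\otimes v\in V^*\otimes V^*\otimes V$, the $\boldsymbol k$-algebra $\{V,m\}$ is the (not necessarily associative) algebra structure on $V$ with product $ab:=\sum\ell(a)\ell'(b)v$. The algebra $\{V,m\}$ is commutative exactly when $m\in\mathcal C$. Simple means having no two-sided ideals other than $0$ and $V$ (the paper's proof shows nonexistence of two-sided ideals of dimension $d$ with $0<d<n$). The automorphism group of $\{V,m\}$ is the stabilizer of $m$ in $\mathrm{GL}(V)$ acting naturally on $V^*\otimes V^*\otimes V$. *)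

theory Defs
  imports "HOL-Analysis.Analysis" "HOL-Computational_Algebra.Polynomial"
begin

text \<open>V = k^n (with its standard basis).  A tensor m in V* (x) V* (x) V is given by its
  coordinates m i j l (the coefficient of e_i* (x) e_j* (x) e_l).\<close>

type_synonym ('k, 'n) tensor3 = "'n \<Rightarrow> 'n \<Rightarrow> 'n \<Rightarrow> 'k"

text \<open>The subspace C of tensors fixed by the involution swapping the two V* factors.\<close>
definition sym_tensors :: "('k, 'n) tensor3 set" where
  "sym_tensors = {m. \<forall>i j l. m i j l = m j i l}"

text \<open>The product of the algebra {V,m}: ab = sum l(a) l'(b) v.\<close>
definition alg_mult :: "('k::comm_ring_1, 'n::finite) tensor3 \<Rightarrow> 'k^'n \<Rightarrow> 'k^'n \<Rightarrow> 'k^'n" where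
  "alg_mult m a b = (\<chi> l. \<Sum>i\<in>UNIV. \<Sum>j\<in>UNIV. a$i * b$j * m i j l)"

definition alg_commutative :: "('k::comm_ring_1, 'n::finite) tensor3 \<Rightarrow> bool" where
  "alg_commutative m \<longleftrightarrow> (\<forall>a b. alg_mult m a b = alg_mult m b a)"

text \<open>Two-sided ideal of {V,m}: a linear subspace closed under multiplication from both sides.\<close>
definition alg_ideal :: "('k::field, 'n::finite) tensor3 \<Rightarrow> ('k^'n) set \<Rightarrow> bool" where
  "alg_ideal m I \<longleftrightarrow> vec.subspace I \<and>
     (\<forall>a x. x \<in> I \<longrightarrow> alg_mult m a x \<in> I \<and> alg_mult m x a \<in> I)"

definition alg_simple :: "('k::field, 'n::finite) tensor3 \<Rightarrow> bool" where
  "alg_simple m \<longleftrightarrow> (\<forall>I. alg_ideal m I \<longrightarrow> I = {0} \<or> I = UNIV)"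

text \<open>Automorphisms of {V,m}: elements of GL(V) preserving the product
  (equivalently, the stabiliser of m in GL(V)).\<close>
definition alg_automorphism :: "('k::field, 'n::finite) tensor3 \<Rightarrow> ('k^'n \<Rightarrow> 'k^'n) \<Rightarrow> bool" where
  "alg_automorphism m g \<longleftrightarrow> Vector_Spaces.linear (*s) (*s) g \<and> bij g \<and>
     (\<forall>a b. g (alg_mult m a b) = alg_mult m (g a) (g b))"

definition trivial_aut_group :: "('k::field, 'n::finite) tensor3 \<Rightarrow> bool" where
  "trivial_aut_group m \<longleftrightarrow> (\<forall>g. alg_automorphism m g \<longrightarrow> g = id)"

text \<open>Polynomial functions in the coordinates of an affine space 'i => 'k.\<close>
inductive_set poly_funs :: "(('i \<Rightarrow> 'k::comm_ring_1) \<Rightarrow> 'k) set" where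
  const: "(\<lambda>x. c) \<in> poly_funs"
| coord: "(\<lambda>x. x i) \<in> poly_funs"
| add: "f \<in> poly_funs \<Longrightarrow> g \<in> poly_funs \<Longrightarrow> (\<lambda>x. f x + g x) \<in> poly_funs"
| mult: "f \<in> poly_funs \<Longrightarrow> g \<in> poly_funs \<Longrightarrow> (\<lambda>x. f x * g x) \<in> poly_funs"

text \<open>Zariski topology on the affine space V* (x) V* (x) V with coordinates indexed by
  triples (i,j,l); the Zariski topology on C is the subspace topology.\<close>
definition zariski_closed :: "(('n \<times> 'n \<times> 'n \<Rightarrow> 'k::comm_ring_1) set) \<Rightarrow> bool" where
  "zariski_closed Z \<longleftrightarrow> (\<exists>F. F \<subseteq> poly_funs \<and> Z = {x. \<forall>f\<in>F. f x = 0})"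

definition zariski_open_in :: "('k::comm_ring_1, 'n) tensor3 set \<Rightarrow> ('k, 'n) tensor3 set \<Rightarrow> bool" where
  "zariski_open_in S U \<longleftrightarrow> U \<subseteq> S \<and>
     (\<exists>Z. zariski_closed Z \<and> U = S - {m. (\<lambda>(i,j,l). m i j l) \<in> Z})"

end

theory Submission
  imports Defs
begin

(* Both properties are guaranteed by the nonvanishing of a polynomial in the structure constants, so
   they hold on the Zariski open set where the product of the two polynomials does not vanish.

   Simplicity: the operators L_(e_0)^p L_(e_(N-1)) L_(e_0)^(N-q) preserve every ideal, and if they
   span End V (a determinant condition) a nonzero ideal must be all of V.

   Trivial automorphisms: an automorphism g preserves the trace form tau(x) = tr L_x, hence fixes the
   element e characterised by tau(x e) = tau(x), hence fixes e, e e, e (e e), ...; if these Krylov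
   vectors form a basis (a determinant condition, made polynomial by Cramer's rule), g = id.

   Each polynomial is nonzero at an explicit commutative structure, and over an infinite field two
   polynomials that are nonzero at two points are simultaneously nonzero on the line through them. *)

definition tensor_poly :: "(('k::comm_ring_1, 'n) tensor3 \<Rightarrow> 'k) \<Rightarrow> bool" where
  "tensor_poly F \<longleftrightarrow> (\<lambda>x. F (\<lambda>i j l. x (i, j, l))) \<in> poly_funs"

lemma tensor_poly_const [intro]: "tensor_poly (\<lambda>m. c)"
  unfolding tensor_poly_def by (rule poly_funs.const)

lemma tensor_poly_coord [intro]: "tensor_poly (\<lambda>m. m i j l)"
  unfolding tensor_poly_def using poly_funs.coord[of "(i, j, l)"] by simp

lemma tensor_poly_add [intro]: "tensor_poly F \<Longrightarrow> tensor_poly G \<Longrightarrow> tensor_poly (\<lambda>m. F m + G m)"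
  unfolding tensor_poly_def by (rule poly_funs.add)

lemma tensor_poly_mult [intro]: "tensor_poly F \<Longrightarrow> tensor_poly G \<Longrightarrow> tensor_poly (\<lambda>m. F m * G m)"
  unfolding tensor_poly_def by (rule poly_funs.mult)

lemma tensor_poly_sum [intro]:
  "(\<And>a. a \<in> A \<Longrightarrow> tensor_poly (F a)) \<Longrightarrow> tensor_poly (\<lambda>m. \<Sum>a\<in>A. F a m)"
  by (induction A rule: infinite_finite_induct) (auto simp: sum.insert)

lemma tensor_poly_prod [intro]:
  "(\<And>a. a \<in> A \<Longrightarrow> tensor_poly (F a)) \<Longrightarrow> tensor_poly (\<lambda>m. \<Prod>a\<in>A. F a m)"
  by (induction A rule: infinite_finite_induct) (auto simp: prod.insert)

lemma tensor_poly_det: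
  fixes A :: "('k::comm_ring_1, 'n) tensor3 \<Rightarrow> 'k^'a::finite^'a"
  assumes "\<And>i j. tensor_poly (\<lambda>m. A m $ i $ j)"
  shows "tensor_poly (\<lambda>m. det (A m))"
  unfolding det_def using assms by (intro tensor_poly_sum tensor_poly_mult tensor_poly_const tensor_poly_prod) auto

definition tensor_poly_vec :: "(('k::comm_ring_1, 'n) tensor3 \<Rightarrow> 'k^'b) \<Rightarrow> bool" where
  "tensor_poly_vec F \<longleftrightarrow> (\<forall>l. tensor_poly (\<lambda>m. F m $ l))"

lemma tensor_poly_vec_const [intro]: "tensor_poly_vec (\<lambda>m. c)"
  unfolding tensor_poly_vec_def by auto

lemma tensor_poly_vec_alg_mult [intro]:
  "tensor_poly_vec F \<Longrightarrow> tensor_poly_vec G \<Longrightarrow> tensor_poly_vec (\<lambda>m. alg_mult m (F m) (G m))"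
  unfolding tensor_poly_vec_def alg_mult_def by (auto intro!: tensor_poly_sum tensor_poly_mult)

lemma tensor_poly_vec_funpow [intro]:
  "tensor_poly_vec F \<Longrightarrow> tensor_poly_vec G \<Longrightarrow> tensor_poly_vec (\<lambda>m. (alg_mult m (F m) ^^ k) (G m))"
  by (induction k) auto

lemma poly_funs_on_line:
  assumes "f \<in> poly_funs"
  shows "\<exists>p. \<forall>t. f (\<lambda>z. a z + t * b z) = poly p t"
  using assms
proof induction
  case (const c)
  show ?case by (intro exI[of _ "[:c:]"]) simp
next
  case (coord i)
  show ?case by (intro exI[of _ "[:a i, b i:]"]) (simp add: mult.commute)
next
  case (add f g)
  then obtain p q where "\<forall>t. f (\<lambda>z. a z + t * b z) = poly p t" "\<forall>t. g (\<lambda>z. a z + t * b z) = poly q t"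
    by blast
  then show ?case by (intro exI[of _ "p + q"]) simp
next
  case (mult f g)
  then obtain p q where "\<forall>t. f (\<lambda>z. a z + t * b z) = poly p t" "\<forall>t. g (\<lambda>z. a z + t * b z) = poly q t"
    by blast
  then show ?case by (intro exI[of _ "p * q"]) simp
qed

lemma tensor_poly_on_line:
  assumes "tensor_poly F"
  shows "\<exists>p. \<forall>t. F (\<lambda>i j l. a i j l + t * (b i j l - a i j l)) = poly p t"
  using poly_funs_on_line[OF assms[unfolded tensor_poly_def],
      of "\<lambda>(i, j, l). a i j l" "\<lambda>(i, j, l). b i j l - a i j l"]
  by simp

lemma tensor_poly_nonzero_on_line:
  fixes F G :: "('k::idom, 'n) tensor3 \<Rightarrow> 'k"
  assumes "infinite (UNIV :: 'k set)" "tensor_poly F" "tensor_poly G" "F a \<noteq> 0" "G b \<noteq> 0"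
  shows "\<exists>t. F (\<lambda>i j l. a i j l + t * (b i j l - a i j l)) \<noteq> 0 \<and>
             G (\<lambda>i j l. a i j l + t * (b i j l - a i j l)) \<noteq> 0"
proof -
  obtain p where p: "\<And>t. F (\<lambda>i j l. a i j l + t * (b i j l - a i j l)) = poly p t"
    using tensor_poly_on_line[OF assms(2)] by blast
  obtain q where q: "\<And>t. G (\<lambda>i j l. a i j l + t * (b i j l - a i j l)) = poly q t"
    using tensor_poly_on_line[OF assms(3)] by blast
  have "poly p 0 \<noteq> 0" "poly q 1 \<noteq> 0"
    using p[of 0] q[of 1] assms(4,5) by simp_all
  then have "p * q \<noteq> 0" by auto
  then have "finite {t. poly (p * q) t = 0}" by (rule poly_roots_finite)
  with assms(1) obtain t where "t \<notin> {t. poly (p * q) t = 0}"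
    using ex_new_if_finite by blast
  then show ?thesis by (auto simp: p q)
qed

lemma zariski_open_in_nonvanishing:
  assumes "tensor_poly F"
  shows "zariski_open_in S {m \<in> S. F m \<noteq> 0}"
  unfolding zariski_open_in_def zariski_closed_def
proof (intro conjI exI)
  let ?f = "\<lambda>x. F (\<lambda>i j l. x (i, j, l))"
  show "{?f} \<subseteq> poly_funs" using assms by (simp add: tensor_poly_def)
  show "{m \<in> S. F m \<noteq> 0} = S - {m. (\<lambda>(i, j, l). m i j l) \<in> {x. \<forall>f\<in>{?f}. f x = 0}}"
    by auto
qed auto

lemma sym_tensors_line:
  "a \<in> sym_tensors \<Longrightarrow> b \<in> sym_tensors \<Longrightarrow> (\<lambda>i j l. a i j l + t * (b i j l - a i j l)) \<in> sym_tensors"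
  unfolding sym_tensors_def by auto

lemma infinite_UNIV_alg_closed_field: "infinite (UNIV :: 'k::alg_closed_field set)"
proof
  assume fin: "finite (UNIV :: 'k set)"
  define q :: "'k poly" where "q = (\<Prod>a\<in>UNIV. [:-a, 1:]) + 1"
  have "degree (\<Prod>a::'k\<in>UNIV. [:-a, 1:]) = card (UNIV :: 'k set)"
    using degree_prod_eq_sum_degree[of UNIV "\<lambda>a::'k. [:-a, 1:]"] by simp
  then have "degree q > 0"
    using fin unfolding q_def by (subst degree_add_eq_left) (auto simp: card_gt_0_iff)
  then obtain x where "poly q x = 0" using alg_closed_imp_poly_has_root by blast
  moreover have "poly (\<Prod>a\<in>UNIV. [:-a, 1:]) x = 0"
    unfolding poly_prod using fin by (intro prod_zero) auto
  ultimately show False by (simp add: q_def)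
qed

definition lmult_matrix :: "('k::comm_ring_1, 'n::finite) tensor3 \<Rightarrow> 'k^'n \<Rightarrow> 'k^'n^'n" where
  "lmult_matrix m a = (\<chi> l j. \<Sum>i\<in>UNIV. a$i * m i j l)"

lemma alg_mult_eq_lmult_matrix: "alg_mult m a x = lmult_matrix m a *v x"
  unfolding alg_mult_def lmult_matrix_def matrix_vector_mult_def
  by (simp add: vec_eq_iff sum_distrib_right) (subst sum.swap, simp add: mult_ac)

lemma linear_alg_mult: "Vector_Spaces.linear (*s) (*s) (alg_mult (m::('k::field, 'n::finite) tensor3) a)"
proof -
  have "alg_mult m a = (*v) (lmult_matrix m a)"
    by (simp add: alg_mult_eq_lmult_matrix fun_eq_iff)
  then show ?thesis by simp
qed

lemma linear_funpow:
  fixes f :: "'k::field^'n \<Rightarrow> 'k^'n"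
  assumes "Vector_Spaces.linear (*s) (*s) f"
  shows "Vector_Spaces.linear (*s) (*s) (f ^^ k)"
proof (induction k)
  case 0
  show ?case using vec.linear_id by (simp add: id_def)
next
  case (Suc k)
  show ?case using Vector_Spaces.linear_compose[OF Suc assms] by (simp add: o_def)
qed

lemma alg_mult_axis: "alg_mult m (axis i 1) (axis j 1) = (\<chi> l. m i j l)"
  unfolding alg_mult_def by (simp add: vec_eq_iff axis_def if_distrib if_distribR sum.If_cases)

lemma alg_mult_scale: "alg_mult m (c *s a) (d *s b) = (c * d) *s alg_mult m a b"
  unfolding alg_mult_def by (simp add: vec_eq_iff sum_distrib_left mult_ac)

lemma alg_commutative_if_sym_tensors: "m \<in> sym_tensors \<Longrightarrow> alg_commutative m"
  unfolding sym_tensors_def alg_commutative_def alg_mult_def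
  by (simp add: vec_eq_iff) (subst sum.swap, simp add: mult_ac)

lemma alg_ideal_mult_left: "alg_ideal m I \<Longrightarrow> x \<in> I \<Longrightarrow> alg_mult m a x \<in> I"
  by (simp add: alg_ideal_def)

lemma alg_ideal_funpow: "alg_ideal m I \<Longrightarrow> x \<in> I \<Longrightarrow> (alg_mult m a ^^ k) x \<in> I"
  by (induction k) (auto intro: alg_ideal_mult_left)

lemma matrix_vector_mult_axis: "A *v axis k 1 = column k (A :: 'a::semiring_1^'n::finite^'m)"
  by (simp add: vec_eq_iff matrix_vector_mult_def column_def axis_def if_distrib if_distribR sum.If_cases)

definition operator_matrix :: "('c \<Rightarrow> 'k^'n \<Rightarrow> 'k^'n) \<Rightarrow> 'k::zero_neq_one^'c^('n \<times> 'n)" where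
  "operator_matrix W = (\<chi> rs c. W c (axis (snd rs) 1) $ fst rs)"

lemma operators_span_matrices:
  fixes W :: "'c::finite \<Rightarrow> 'k::field^'n::finite \<Rightarrow> 'k^'n"
  assumes lin: "\<And>c. Vector_Spaces.linear (*s) (*s) (W c)" and inv: "invertible (operator_matrix W)"
  shows "\<exists>coef. \<forall>v. (\<Sum>c\<in>UNIV. coef $ c *s W c v) = A *v v"
proof -
  obtain M' where M': "operator_matrix W ** M' = mat 1"
    using inv unfolding invertible_def by blast
  define coef where "coef = M' *v (\<chi> rs. A $ fst rs $ snd rs)"
  have entries: "(\<Sum>c\<in>UNIV. coef $ c * W c (axis s 1) $ r) = A $ r $ s" for r s
  proof -
    have "operator_matrix W *v coef = (\<chi> rs. A $ fst rs $ snd rs)"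
      by (simp add: coef_def matrix_vector_mul_assoc M')
    then show ?thesis
      by (simp add: vec_eq_iff matrix_vector_mult_def operator_matrix_def mult.commute)
  qed
  have "(\<Sum>c\<in>UNIV. coef $ c *s W c v) $ r = (A *v v) $ r" for v r
  proof -
    have "(\<Sum>c\<in>UNIV. coef $ c *s W c v) $ r
        = (\<Sum>c\<in>UNIV. coef $ c * (\<Sum>s\<in>UNIV. v $ s * W c (axis s 1) $ r))"
      by (simp only: sum_component vector_smult_component Cartesian_Space.linear_componentwise[OF lin, symmetric])
    also have "\<dots> = (\<Sum>s\<in>UNIV. v $ s * (\<Sum>c\<in>UNIV. coef $ c * W c (axis s 1) $ r))"
      by (simp add: sum_distrib_left mult_ac) (rule sum.swap)
    also have "\<dots> = (A *v v) $ r"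
      by (simp add: entries matrix_vector_mult_def mult.commute)
    finally show ?thesis .
  qed
  then show ?thesis by (auto simp: vec_eq_iff)
qed

lemma subspace_invariant_under_matrices:
  fixes I :: "('k::field^'n::finite) set"
  assumes "vec.subspace I" "I \<noteq> {0}" and inv: "\<And>A x. x \<in> I \<Longrightarrow> A *v x \<in> I"
  shows "I = UNIV"
proof -
  obtain x where x: "x \<in> I" "x \<noteq> 0"
    using assms(1,2) vec.subspace_0 by blast
  then obtain s where s: "x $ s \<noteq> 0" by (auto simp: vec_eq_iff)
  have "y \<in> I" for y
  proof -
    have "(\<chi> r t. if t = s then y $ r / x $ s else 0) *v x = y"
      using s by (simp add: vec_eq_iff matrix_vector_mult_def if_distrib if_distribR sum.If_cases)
    then show ?thesis using inv[OF x(1)] by metis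
  qed
  then show ?thesis by auto
qed

lemma subspace_invariant_under_spanning_operators:
  fixes W :: "'c::finite \<Rightarrow> 'k::field^'n::finite \<Rightarrow> 'k^'n"
  assumes "\<And>c. Vector_Spaces.linear (*s) (*s) (W c)" "invertible (operator_matrix W)"
    and sub: "vec.subspace I" "I \<noteq> {0}" and inv: "\<And>c x. x \<in> I \<Longrightarrow> W c x \<in> I"
  shows "I = UNIV"
proof (rule subspace_invariant_under_matrices[OF sub])
  fix A and x :: "'k^'n" assume "x \<in> I"
  obtain coef where "\<forall>v. (\<Sum>c\<in>UNIV. coef $ c *s W c v) = A *v v"
    using operators_span_matrices[OF assms(1,2)] by blast
  moreover have "(\<Sum>c\<in>UNIV. coef $ c *s W c x) \<in> I"
    using \<open>x \<in> I\<close> by (intro vec.subspace_sum[OF sub(1)] vec.subspace_scale[OF sub(1)] inv)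
  ultimately show "A *v x \<in> I" by simp
qed

definition idx :: "'n::finite \<Rightarrow> nat" where
  "idx = (SOME h. bij_betw h (UNIV :: 'n set) {..<CARD('n)})"

definition idx_inv :: "nat \<Rightarrow> 'n::finite" where
  "idx_inv = inv_into UNIV idx"

lemma bij_betw_idx: "bij_betw (idx :: 'n::finite \<Rightarrow> nat) UNIV {..<CARD('n)}"
proof -
  have "\<exists>h. bij_betw h (UNIV :: 'n set) {..<CARD('n)}"
    using ex_bij_betw_finite_nat[of "UNIV :: 'n set"] by (simp add: atLeast0LessThan)
  then show ?thesis unfolding idx_def by (rule someI_ex)
qed

lemma idx_less [simp]: "idx (i :: 'n::finite) < CARD('n)"
  using bij_betw_idx[where 'n='n] unfolding bij_betw_def by auto

lemma idx_inv_idx [simp]: "idx_inv (idx (i :: 'n::finite)) = i"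
  using bij_betw_idx[where 'n='n] unfolding idx_inv_def bij_betw_def by auto

lemma idx_idx_inv [simp]: "k < CARD('n) \<Longrightarrow> idx (idx_inv k :: 'n::finite) = k"
  using bij_betw_idx[where 'n='n] unfolding idx_inv_def bij_betw_def by (auto simp: f_inv_into_f)

lemma idx_eq_iff [simp]: "idx (i :: 'n::finite) = idx j \<longleftrightarrow> i = j"
  by (metis idx_inv_idx)

lemma sum_idx: "(\<Sum>i\<in>(UNIV :: 'n::finite set). f (idx i)) = (\<Sum>k<CARD('n). f k)"
  by (rule sum.reindex_bij_betw[OF bij_betw_idx])

definition basis_vec :: "nat \<Rightarrow> 'k::zero_neq_one^'n::finite" where
  "basis_vec k = axis (idx_inv k) 1"

lemma axis_eq_basis_vec: "axis i 1 = basis_vec (idx i)"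
  by (simp add: basis_vec_def)

(* For the cyclic tensor below these are exactly the matrix units. *)
definition simplicity_ops :: "('k::field, 'n::finite) tensor3 \<Rightarrow> 'n \<times> 'n \<Rightarrow> 'k^'n \<Rightarrow> 'k^'n" where
  "simplicity_ops m pq =
     (alg_mult m (basis_vec 0) ^^ idx (fst pq)) \<circ> alg_mult m (basis_vec (CARD('n) - 1)) \<circ>
     (alg_mult m (basis_vec 0) ^^ (CARD('n) - idx (snd pq)))"

definition simplicity_poly :: "('k::field, 'n::finite) tensor3 \<Rightarrow> 'k" where
  "simplicity_poly m = det (operator_matrix (simplicity_ops m))"

lemma tensor_poly_vec_simplicity_ops: "tensor_poly_vec (\<lambda>m. simplicity_ops m pq v)"
  unfolding simplicity_ops_def o_apply
  by (intro tensor_poly_vec_funpow tensor_poly_vec_alg_mult tensor_poly_vec_const)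

lemma tensor_poly_simplicity_poly: "tensor_poly (simplicity_poly :: ('k::field, 'n::finite) tensor3 \<Rightarrow> 'k)"
  unfolding simplicity_poly_def operator_matrix_def
  by (rule tensor_poly_det) (simp add: tensor_poly_vec_simplicity_ops[unfolded tensor_poly_vec_def])

lemma linear_simplicity_ops: "Vector_Spaces.linear (*s) (*s) (simplicity_ops m pq)"
  unfolding simplicity_ops_def
  by (intro Vector_Spaces.linear_compose[OF linear_funpow[OF linear_alg_mult]]
      Vector_Spaces.linear_compose[OF linear_alg_mult] linear_funpow linear_alg_mult)

lemma alg_ideal_simplicity_ops: "alg_ideal m I \<Longrightarrow> x \<in> I \<Longrightarrow> simplicity_ops m pq x \<in> I"
  unfolding simplicity_ops_def o_apply
  by (intro alg_ideal_funpow alg_ideal_mult_left)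

lemma alg_simple_if_simplicity_poly:
  fixes m :: "('k::field, 'n::finite) tensor3"
  assumes "simplicity_poly m \<noteq> 0"
  shows "alg_simple m"
  unfolding alg_simple_def
proof (intro allI impI)
  fix I assume I: "alg_ideal m I"
  have "I = UNIV" if "I \<noteq> {0}"
  proof (rule subspace_invariant_under_spanning_operators[OF linear_simplicity_ops])
    show "invertible (operator_matrix (simplicity_ops m))"
      using assms by (simp add: simplicity_poly_def invertible_det_nz)
    show "vec.subspace I" using I by (simp add: alg_ideal_def)
    show "simplicity_ops m pq x \<in> I" if "x \<in> I" for pq x
      using I that by (rule alg_ideal_simplicity_ops)
  qed fact
  then show "I = {0} \<or> I = UNIV" by blast
qed

definition alg_trace :: "('k::comm_ring_1, 'n::finite) tensor3 \<Rightarrow> 'k^'n \<Rightarrow> 'k" where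
  "alg_trace m a = trace (lmult_matrix m a)"

definition trace_vec :: "('k::comm_ring_1, 'n::finite) tensor3 \<Rightarrow> 'k^'n" where
  "trace_vec m = (\<chi> i. alg_trace m (axis i 1))"

definition trace_form :: "('k::comm_ring_1, 'n::finite) tensor3 \<Rightarrow> 'k^'n^'n" where
  "trace_form m = (\<chi> i j. alg_trace m (alg_mult m (axis i 1) (axis j 1)))"

(* By Cramer's rule, det (trace_form m) times the solution e of trace_form m *v e = trace_vec m;
   unlike e it is polynomial in m. *)
definition trace_unit :: "('k::comm_ring_1, 'n::finite) tensor3 \<Rightarrow> 'k^'n" where
  "trace_unit m = (\<chi> k. det (\<chi> i j. if j = k then trace_vec m $ i else trace_form m $ i $ j))"

definition krylov :: "('k::comm_ring_1, 'n::finite) tensor3 \<Rightarrow> nat \<Rightarrow> 'k^'n" where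
  "krylov m k = (alg_mult m (trace_unit m) ^^ k) (trace_unit m)"

definition krylov_matrix :: "('k::comm_ring_1, 'n::finite) tensor3 \<Rightarrow> 'k^'n^'n" where
  "krylov_matrix m = (\<chi> r p. krylov m (idx p) $ r)"

definition rigidity_poly :: "('k::comm_ring_1, 'n::finite) tensor3 \<Rightarrow> 'k" where
  "rigidity_poly m = det (trace_form m) * det (krylov_matrix m)"

lemma alg_trace_expand: "alg_trace m a = (\<Sum>i\<in>UNIV. \<Sum>l\<in>UNIV. a $ i * m i l l)"
  unfolding alg_trace_def trace_def lmult_matrix_def by (simp only: vec_lambda_beta) (rule sum.swap)

lemma trace_vec_eq: "trace_vec m $ i = (\<Sum>l\<in>UNIV. m i l l)"
  by (simp add: trace_vec_def alg_trace_expand axis_def if_distrib if_distribR sum.If_cases)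

lemma alg_trace_eq: "alg_trace m a = (\<Sum>i\<in>UNIV. a $ i * trace_vec m $ i)"
  by (simp add: alg_trace_expand trace_vec_eq sum_distrib_left)

lemma trace_form_eq: "trace_form m $ i $ j = (\<Sum>l\<in>UNIV. m i j l * trace_vec m $ l)"
  by (simp add: trace_form_def alg_mult_axis alg_trace_eq)

lemma alg_trace_alg_mult:
  "alg_trace m (alg_mult m x y) = (\<Sum>i\<in>UNIV. \<Sum>j\<in>UNIV. x $ i * y $ j * trace_form m $ i $ j)"
proof -
  have "alg_trace m (alg_mult m x y)
      = (\<Sum>l\<in>UNIV. \<Sum>i\<in>UNIV. \<Sum>j\<in>UNIV. x $ i * y $ j * (m i j l * trace_vec m $ l))"
    by (simp add: alg_trace_eq alg_mult_def sum_distrib_left sum_distrib_right mult_ac)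
  also have "\<dots> = (\<Sum>i\<in>UNIV. \<Sum>j\<in>UNIV. \<Sum>l\<in>UNIV. x $ i * y $ j * (m i j l * trace_vec m $ l))"
    by (subst sum.swap) (rule sum.cong[OF refl], rule sum.swap)
  finally show ?thesis
    by (simp add: trace_form_eq sum_distrib_left)
qed

lemma trace_form_mult_vec: "(trace_form m *v y) $ i = alg_trace m (alg_mult m (axis i 1) y)"
  by (simp add: alg_trace_alg_mult matrix_vector_mult_def axis_def mult_ac
      if_distrib if_distribR sum.If_cases)

lemma tensor_poly_alg_trace: "tensor_poly_vec F \<Longrightarrow> tensor_poly (\<lambda>m. alg_trace m (F m))"
  unfolding tensor_poly_vec_def alg_trace_def trace_def lmult_matrix_def
  by (auto intro!: tensor_poly_sum tensor_poly_mult)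

lemma tensor_poly_rigidity_poly: "tensor_poly (rigidity_poly :: ('k::comm_ring_1, 'n::finite) tensor3 \<Rightarrow> 'k)"
proof -
  have form: "tensor_poly (\<lambda>m::('k, 'n) tensor3. trace_form m $ i $ j)" for i j
    unfolding trace_form_def vec_lambda_beta
    by (intro tensor_poly_alg_trace tensor_poly_vec_alg_mult tensor_poly_vec_const)
  have vec: "tensor_poly (\<lambda>m::('k, 'n) tensor3. trace_vec m $ i)" for i
    unfolding trace_vec_def vec_lambda_beta by (intro tensor_poly_alg_trace tensor_poly_vec_const)
  have "tensor_poly (\<lambda>m::('k, 'n) tensor3. trace_unit m $ k)" for k
    unfolding trace_unit_def vec_lambda_beta
  proof (rule tensor_poly_det)
    fix i j
    show "tensor_poly (\<lambda>m::('k, 'n) tensor3.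
        (\<chi> i j. if j = k then trace_vec m $ i else trace_form m $ i $ j) $ i $ j)"
      by (cases "j = k") (simp_all add: form vec)
  qed
  then have unit: "tensor_poly_vec (trace_unit :: ('k, 'n) tensor3 \<Rightarrow> _)"
    unfolding tensor_poly_vec_def by blast
  have "tensor_poly (\<lambda>m::('k, 'n) tensor3. krylov_matrix m $ r $ p)" for r p
    using tensor_poly_vec_funpow[OF unit unit]
    unfolding krylov_matrix_def krylov_def tensor_poly_vec_def by simp
  then show ?thesis
    unfolding rigidity_poly_def[abs_def] by (intro tensor_poly_mult tensor_poly_det form)
qed

lemma det_ones_plus_diagonal_ne_0:
  fixes d :: "'n::finite \<Rightarrow> 'k::field"
  assumes "d i0 = 0" and nz: "\<And>i. i \<noteq> i0 \<Longrightarrow> d i \<noteq> 0"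
  shows "det (\<chi> i j. 1 + of_bool (i = j) * d i) \<noteq> 0"
proof -
  let ?A = "\<chi> i j. 1 + of_bool (i = j) * d i :: 'k^'n^'n"
  have "x = 0" if "?A *v x = 0" for x
  proof -
    have row: "(\<Sum>j\<in>UNIV. x $ j) + d i * x $ i = 0" for i
    proof -
      have "(?A *v x) $ i = (\<Sum>j\<in>UNIV. x $ j) + d i * x $ i"
        by (simp add: matrix_vector_mult_def ring_distribs sum.distrib mult.assoc)
      then show ?thesis using that by simp
    qed
    have total: "(\<Sum>j\<in>UNIV. x $ j) = 0"
      using row[of i0] assms(1) by simp
    have off: "x $ i = 0" if "i \<noteq> i0" for i
      using row[of i] nz[OF that] total by simp
    have "(\<Sum>j\<in>UNIV. x $ j) = (\<Sum>j\<in>UNIV. if j = i0 then x $ j else 0)"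
      by (rule sum.cong) (auto simp: off)
    then have "x $ i0 = 0" using total by simp
    with off show "x = 0" by (metis vec_eq_iff zero_index)
  qed
  then have "inj ((*v) ?A)"
    by (simp add: vec.linear_inj_iff_eq_0[OF matrix_vector_mul_linear_gen])
  then show ?thesis
    using det_nz_iff_inj_gen[OF matrix_vector_mul_linear_gen[of ?A]] by simp
qed

lemma trace_eq_if_similar:
  fixes A B G :: "'k::field^'n::finite^'n"
  assumes "invertible G" "A ** G = G ** B"
  shows "trace A = trace B"
proof -
  obtain H where GH: "G ** H = mat 1" and HG: "H ** G = mat 1"
    using assms(1) unfolding invertible_def by blast
  have "A = (A ** G) ** H"
    by (simp add: matrix_mul_assoc[symmetric] GH)
  then have "trace A = trace ((G ** B) ** H)"
    by (simp add: assms(2))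
  also have "\<dots> = trace (H ** (G ** B))"
    by (rule trace_mul_sym)
  also have "\<dots> = trace B"
    by (simp add: matrix_mul_assoc HG)
  finally show ?thesis .
qed

lemma alg_trace_automorphism:
  assumes "alg_automorphism m g"
  shows "alg_trace m (g a) = alg_trace m a"
proof -
  have lin: "Vector_Spaces.linear (*s) (*s) g" and "bij g"
    and hom: "\<And>a b. g (alg_mult m a b) = alg_mult m (g a) (g b)"
    using assms unfolding alg_automorphism_def by auto
  have gx: "g x = matrix g *v x" for x
    by (simp add: matrix_works[OF lin])
  have "invertible (matrix g)"
    using \<open>bij g\<close> by (simp add: invertible_eq_bij gx[abs_def, symmetric])
  moreover have "lmult_matrix m (g a) ** matrix g = matrix g ** lmult_matrix m a"
  proof (rule matrix_eq[THEN iffD2], intro allI)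
    fix x
    have "(lmult_matrix m (g a) ** matrix g) *v x = alg_mult m (g a) (g x)"
      by (simp add: alg_mult_eq_lmult_matrix gx matrix_vector_mul_assoc[symmetric])
    also have "\<dots> = g (alg_mult m a x)" by (simp add: hom)
    also have "\<dots> = (matrix g ** lmult_matrix m a) *v x"
      by (simp add: alg_mult_eq_lmult_matrix gx matrix_vector_mul_assoc[symmetric])
    finally show "(lmult_matrix m (g a) ** matrix g) *v x = (matrix g ** lmult_matrix m a) *v x" .
  qed
  ultimately show ?thesis
    unfolding alg_trace_def by (rule trace_eq_if_similar)
qed

lemma trace_form_solution_iff:
  "trace_form m *v e = trace_vec m \<longleftrightarrow> (\<forall>x. alg_trace m (alg_mult m x e) = alg_trace m x)"
proof
  assume e: "trace_form m *v e = trace_vec m"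
  show "\<forall>x. alg_trace m (alg_mult m x e) = alg_trace m x"
  proof
    fix x
    have "alg_trace m (alg_mult m x e) = (\<Sum>i\<in>UNIV. x $ i * (trace_form m *v e) $ i)"
      by (simp add: alg_trace_alg_mult matrix_vector_mult_def sum_distrib_left mult_ac)
    then show "alg_trace m (alg_mult m x e) = alg_trace m x"
      by (simp add: e alg_trace_eq)
  qed
next
  assume "\<forall>x. alg_trace m (alg_mult m x e) = alg_trace m x"
  then show "trace_form m *v e = trace_vec m"
    by (simp add: vec_eq_iff trace_form_mult_vec trace_vec_def)
qed

lemma trace_unit_eq_scaled:
  fixes m :: "('k::field, 'n::finite) tensor3"
  assumes "trace_form m *v e = trace_vec m"
  shows "trace_unit m = det (trace_form m) *s e"
proof (subst vec_eq_iff, intro allI)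
  fix k
  have "trace_unit m $ k = det (\<chi> i j. if j = k then (trace_form m *v e) $ i else trace_form m $ i $ j)"
    by (simp only: trace_unit_def assms vec_lambda_beta)
  also have "\<dots> = e $ k * det (trace_form m)"
    by (rule cramer_lemma)
  finally show "trace_unit m $ k = (det (trace_form m) *s e) $ k"
    by (simp add: mult.commute)
qed

lemma automorphism_fixes_trace_unit:
  fixes m :: "('k::field, 'n::finite) tensor3"
  assumes aut: "alg_automorphism m g" and det: "det (trace_form m) \<noteq> 0"
  shows "g (trace_unit m) = trace_unit m"
proof -
  have lin: "Vector_Spaces.linear (*s) (*s) g" and "surj g"
    and hom: "\<And>a b. g (alg_mult m a b) = alg_mult m (g a) (g b)"
    using aut unfolding alg_automorphism_def by (auto simp: bij_is_surj)
  have inv: "invertible (trace_form m)"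
    using det by (simp add: invertible_det_nz)
  then obtain e where e: "trace_form m *v e = trace_vec m"
    using invertible_eq_bij bij_is_surj by (metis surj_def)
  have "alg_trace m (alg_mult m x (g e)) = alg_trace m x" for x
  proof -
    obtain y where y: "x = g y" using \<open>surj g\<close> by blast
    have "alg_trace m (alg_mult m x (g e)) = alg_trace m (alg_mult m y e)"
      by (simp add: y hom[symmetric] alg_trace_automorphism[OF aut])
    also have "\<dots> = alg_trace m x"
      using e by (simp add: trace_form_solution_iff y alg_trace_automorphism[OF aut])
    finally show ?thesis .
  qed
  then have "trace_form m *v g e = trace_form m *v e"
    by (simp add: e trace_form_solution_iff)
  then have "g e = e"
    using inv by (simp add: invertible_eq_bij bij_is_inj inj_eq)
  then show ?thesis
    by (simp add: trace_unit_eq_scaled[OF e] vec.linear_scale[OF lin])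
qed

lemma automorphism_fixes_funpow:
  assumes "alg_automorphism m g" "g u = u"
  shows "g ((alg_mult m u ^^ k) u) = (alg_mult m u ^^ k) u"
  using assms by (induction k) (simp_all add: alg_automorphism_def)

lemma linear_eq_id_if_fixes_columns:
  fixes g :: "'k::field^'n::finite \<Rightarrow> 'k^'n"
  assumes lin: "Vector_Spaces.linear (*s) (*s) g" and "invertible K"
    and fixed: "\<And>p. g (column p K) = column p K"
  shows "g = id"
proof
  fix x
  obtain c where "x = K *v c"
    using \<open>invertible K\<close> by (metis invertible_eq_bij bij_is_surj surj_def)
  then have x: "x = (\<Sum>p\<in>UNIV. c $ p *s column p K)"
    by (simp add: matrix_mult_sum)
  show "g x = id x"
    by (subst (1 2) x) (simp add: vec.linear_sum[OF lin] vec.linear_scale[OF lin] fixed)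
qed

lemma trivial_aut_group_if_rigidity_poly:
  fixes m :: "('k::field, 'n::finite) tensor3"
  assumes "rigidity_poly m \<noteq> 0"
  shows "trivial_aut_group m"
  unfolding trivial_aut_group_def
proof (intro allI impI)
  fix g assume aut: "alg_automorphism m g"
  have B: "det (trace_form m) \<noteq> 0" and K: "invertible (krylov_matrix m)"
    using assms by (auto simp: rigidity_poly_def invertible_det_nz)
  from aut B have "g (trace_unit m) = trace_unit m"
    by (rule automorphism_fixes_trace_unit)
  then have "g (column p (krylov_matrix m)) = column p (krylov_matrix m)" for p
    by (simp add: column_def krylov_matrix_def krylov_def automorphism_fixes_funpow[OF aut])
  moreover have "Vector_Spaces.linear (*s) (*s) g"
    using aut by (simp add: alg_automorphism_def)
  ultimately show "g = id"
    using K by (intro linear_eq_id_if_fixes_columns)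
qed

lemma axis_idx_inv: "k < CARD('n) \<Longrightarrow> axis (idx_inv k :: 'n::finite) 1 = (\<chi> l. of_bool (idx l = k))"
  unfolding axis_def by (auto simp: vec_eq_iff)

lemma add_diff_mod_eq_0_iff: "a < (N::nat) \<Longrightarrow> b < N \<Longrightarrow> (a + (N - b)) mod N = 0 \<longleftrightarrow> a = b"
  using add.commute gr_zeroI less_diff_conv less_imp_add_positive mod_if by auto

definition cyclic_tensor :: "('k::field, 'n::finite) tensor3" where
  "cyclic_tensor i j l =
     (if idx i = 0 then of_bool (idx l = Suc (idx j) mod CARD('n))
      else if idx j = 0 then of_bool (idx l = Suc (idx i) mod CARD('n)) else 0)"

lemma cyclic_tensor_sym: "cyclic_tensor \<in> sym_tensors"
  unfolding sym_tensors_def cyclic_tensor_def by auto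

lemma cyclic_tensor_mult_first:
  "k < CARD('n) \<Longrightarrow>
     alg_mult (cyclic_tensor :: ('k::field, 'n::finite) tensor3) (basis_vec 0) (basis_vec k)
       = basis_vec (Suc k mod CARD('n))"
  unfolding basis_vec_def alg_mult_axis cyclic_tensor_def by (simp add: axis_idx_inv)

lemma cyclic_tensor_funpow:
  "k < CARD('n) \<Longrightarrow>
     (alg_mult (cyclic_tensor :: ('k::field, 'n::finite) tensor3) (basis_vec 0) ^^ r) (basis_vec k)
       = basis_vec ((k + r) mod CARD('n))"
  by (induction r) (simp_all add: cyclic_tensor_mult_first mod_Suc_eq)

lemma cyclic_tensor_mult_last:
  "k < CARD('n) \<Longrightarrow>
     alg_mult (cyclic_tensor :: ('k::field, 'n::finite) tensor3) (basis_vec (CARD('n) - 1)) (basis_vec k)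
       = of_bool (k = 0) *s basis_vec 0"
  unfolding basis_vec_def alg_mult_axis cyclic_tensor_def
  by (cases "CARD('n) = 1") (auto simp: axis_idx_inv vec_eq_iff mod_Suc)

lemma cyclic_tensor_simplicity_ops:
  "simplicity_ops (cyclic_tensor :: ('k::field, 'n::finite) tensor3) (p, q) (axis s 1) = of_bool (s = q) *s axis p 1"
proof -
  let ?N = "CARD('n)"
  have "(alg_mult (cyclic_tensor :: ('k, 'n) tensor3) (basis_vec 0) ^^ (?N - idx q)) (axis s 1)
      = basis_vec ((idx s + (?N - idx q)) mod ?N)"
    by (simp add: axis_eq_basis_vec cyclic_tensor_funpow)
  moreover have "alg_mult (cyclic_tensor :: ('k, 'n) tensor3) (basis_vec (?N - 1))
      (basis_vec ((idx s + (?N - idx q)) mod ?N)) = of_bool (s = q) *s basis_vec 0"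
    using cyclic_tensor_mult_last[where 'k='k and 'n='n, of "(idx s + (?N - idx q)) mod ?N"]
      add_diff_mod_eq_0_iff[of "idx s" ?N "idx q"]
    by simp
  moreover have
    "(alg_mult (cyclic_tensor :: ('k, 'n) tensor3) (basis_vec 0) ^^ idx p) (c *s basis_vec 0) = c *s axis p 1" for c
    using cyclic_tensor_funpow[where 'k='k and 'n='n, of 0 "idx p"]
    by (simp add: vec.linear_scale[OF linear_funpow[OF linear_alg_mult]] axis_eq_basis_vec)
  ultimately show ?thesis
    by (simp add: simplicity_ops_def)
qed

lemma simplicity_poly_cyclic_tensor: "simplicity_poly (cyclic_tensor :: ('k::field, 'n::finite) tensor3) = 1"
proof -
  have "operator_matrix (simplicity_ops (cyclic_tensor :: ('k, 'n) tensor3)) = mat 1"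
    unfolding operator_matrix_def mat_def
    by (simp add: vec_eq_iff cyclic_tensor_simplicity_ops) (simp add: axis_def)
  then show ?thesis by (simp add: simplicity_poly_def)
qed

(* The algebra with e_0 e_k = e_(k+1) for k < N - 1, e_0 e_(N-1) = 2 e_0 - e_(N-1),
   e_a e_a = -e_a for 0 < a < N - 1, e_(N-1) e_(N-1) = -3 e_(N-1) and e_a e_b = e_0 for distinct
   nonzero a, b.  All e_i have the same trace, which makes e_0 the solution of the trace equation,
   and its Krylov vectors are then multiples of e_0, ..., e_(N-1). *)
definition rigid_coeff :: "nat \<Rightarrow> nat \<Rightarrow> nat \<Rightarrow> nat \<Rightarrow> 'k::comm_ring_1" where
  "rigid_coeff N a b c =
     (if a = 0 \<or> b = 0 then
        (if a + b = N - 1 then 2 * of_bool (c = 0) - of_bool (c = N - 1) else of_bool (c = Suc (a + b)))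
      else if a = b then (if c = a then (if a = N - 1 then -3 else -1) else 0)
      else of_bool (c = 0))"

definition rigid_trace :: "nat \<Rightarrow> 'k::comm_ring_1" where
  "rigid_trace N = (if N = 1 then 1 else -1)"

definition rigid_diag :: "nat \<Rightarrow> nat \<Rightarrow> 'k::comm_ring_1" where
  "rigid_diag N a = (if a = 0 then 0 else if a = N - 1 then -4 else -2)"

lemma rigid_coeff_diag_sum: "a < N \<Longrightarrow> (\<Sum>c<N. rigid_coeff N a c c) = (rigid_trace N :: 'k::comm_ring_1)"
proof (cases "a = 0")
  case True
  assume "a < N"
  have "(\<Sum>c<N. rigid_coeff N a c c) = (\<Sum>c<N. if c = N - 1 then 2 * of_bool (N - 1 = 0) - 1 else (0::'k))"
    using True by (intro sum.cong) (auto simp: rigid_coeff_def)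
  also have "\<dots> = rigid_trace N"
    using \<open>a < N\<close> by (auto simp: rigid_trace_def)
  finally show ?thesis .
next
  case False
  assume "a < N"
  then have "N \<noteq> 1" using False by auto
  have "(\<Sum>c<N. rigid_coeff N a c c) = (\<Sum>c<N. of_bool (c = 0) * (if a = N - 1 then 2 else 0)
          + of_bool (c = a) * (if a = N - 1 then -3 else (-1::'k)))"
    using False by (intro sum.cong) (auto simp: rigid_coeff_def)
  also have "\<dots> = rigid_trace N"
    using \<open>a < N\<close> \<open>N \<noteq> 1\<close> by (simp add: sum.distrib rigid_trace_def)
  finally show ?thesis .
qed

lemma rigid_coeff_sum:
  assumes "a < N" "b < N"
  shows "(\<Sum>c<N. rigid_coeff N a b c) = (1 + of_bool (a = b) * rigid_diag N a :: 'k::comm_ring_1)"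
proof (cases "a = 0 \<or> b = 0")
  case True
  then have "a + b < N" using assms by auto
  then show ?thesis
    using True by (cases "a + b = N - 1")
      (auto simp: rigid_coeff_def rigid_diag_def sum_subtractf sum_distrib_left[symmetric])
next
  case False
  then show ?thesis
    using assms by (auto simp: rigid_coeff_def rigid_diag_def)
qed

lemma rigid_coeff_commute: "rigid_coeff N a b c = rigid_coeff N b a c"
  unfolding rigid_coeff_def by (cases "a = b") (simp_all add: add.commute conj_disj_distribL)

definition rigid_tensor :: "('k::field, 'n::finite) tensor3" where
  "rigid_tensor i j l = rigid_coeff CARD('n) (idx i) (idx j) (idx l)"

lemma rigid_tensor_sym: "rigid_tensor \<in> sym_tensors"
  unfolding sym_tensors_def rigid_tensor_def using rigid_coeff_commute by blast

lemma rigid_tensor_trace_vec: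
  "trace_vec (rigid_tensor :: ('k::field, 'n::finite) tensor3) $ i = rigid_trace CARD('n)"
  using sum_idx[where 'n='n and f="\<lambda>c. rigid_coeff CARD('n) (idx i) c c :: 'k"]
  by (simp add: trace_vec_eq rigid_tensor_def rigid_coeff_diag_sum)

lemma rigid_tensor_trace_form:
  "trace_form (rigid_tensor :: ('k::field, 'n::finite) tensor3) $ i $ j
     = rigid_trace CARD('n) * (1 + of_bool (i = j) * rigid_diag CARD('n) (idx i))"
proof -
  have "trace_form (rigid_tensor :: ('k, 'n) tensor3) $ i $ j
      = (\<Sum>l::'n\<in>UNIV. rigid_coeff CARD('n) (idx i) (idx j) (idx l)) * rigid_trace CARD('n)"
    by (simp add: trace_form_eq rigid_tensor_trace_vec rigid_tensor_def sum_distrib_right)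
  also have "\<dots> = rigid_trace CARD('n) * (1 + of_bool (i = j) * rigid_diag CARD('n) (idx i))"
    by (simp add: sum_idx[where f="rigid_coeff CARD('n) (idx i) (idx j)"] rigid_coeff_sum mult.commute)
  finally show ?thesis .
qed

lemma rigid_tensor_trace_equation:
  "trace_form (rigid_tensor :: ('k::field, 'n::finite) tensor3) *v basis_vec 0 = trace_vec rigid_tensor"
  by (simp add: vec_eq_iff basis_vec_def matrix_vector_mult_axis column_def rigid_tensor_trace_form
      rigid_tensor_trace_vec rigid_diag_def)

lemma det_rigid_tensor_trace_form:
  assumes "(2::'k::field) \<noteq> 0"
  shows "det (trace_form (rigid_tensor :: ('k, 'n::finite) tensor3)) \<noteq> 0"
proof -
  let ?t = "rigid_trace CARD('n) :: 'k"
  let ?d = "\<lambda>i::'n. rigid_diag CARD('n) (idx i) :: 'k"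
  have "trace_form (rigid_tensor :: ('k, 'n) tensor3) = (\<chi> i. ?t *s (\<chi> j. 1 + of_bool (i = j) * ?d i))"
    by (simp add: vec_eq_iff rigid_tensor_trace_form)
  then have "det (trace_form (rigid_tensor :: ('k, 'n) tensor3))
      = ?t ^ CARD('n) * det (\<chi> i j. 1 + of_bool (i = j) * ?d i)"
    by (simp add: det_rows_mul)
  moreover have "?t \<noteq> 0" by (simp add: rigid_trace_def)
  moreover have "?d i \<noteq> 0" if "i \<noteq> idx_inv 0" for i
  proof -
    have "idx i \<noteq> 0" using that by (metis idx_inv_idx)
    moreover have "(4::'k) \<noteq> 0" using assms by (metis mult_2 mult_eq_0_iff numeral_Bit0)
    ultimately show ?thesis using assms by (simp add: rigid_diag_def)
  qed
  moreover have "?d (idx_inv 0) = 0" by (simp add: rigid_diag_def)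
  ultimately show ?thesis
    using det_ones_plus_diagonal_ne_0[of ?d "idx_inv 0"] by simp
qed

lemma rigid_tensor_mult_first:
  "Suc k < CARD('n) \<Longrightarrow>
     alg_mult (rigid_tensor :: ('k::field, 'n::finite) tensor3) (basis_vec 0) (basis_vec k) = basis_vec (Suc k)"
  unfolding basis_vec_def alg_mult_axis rigid_tensor_def
  by (simp add: rigid_coeff_def axis_idx_inv fun_eq_iff, linarith)

lemma rigid_tensor_krylov:
  assumes "k < CARD('n)" and d: "d = det (trace_form (rigid_tensor :: ('k::field, 'n::finite) tensor3))"
  shows "krylov (rigid_tensor :: ('k, 'n) tensor3) k = d ^ Suc k *s basis_vec k"
  using assms(1)
proof (induction k)
  case 0
  show ?case
    by (simp add: krylov_def d trace_unit_eq_scaled[OF rigid_tensor_trace_equation])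
next
  case (Suc k)
  have "krylov (rigid_tensor :: ('k, 'n) tensor3) (Suc k)
      = alg_mult rigid_tensor (d *s basis_vec 0) (krylov rigid_tensor k)"
    by (simp add: krylov_def d trace_unit_eq_scaled[OF rigid_tensor_trace_equation])
  also have "\<dots> = d ^ Suc (Suc k) *s basis_vec (Suc k)"
    using Suc by (simp add: alg_mult_scale rigid_tensor_mult_first)
  finally show ?case .
qed

lemma rigidity_poly_rigid_tensor:
  assumes "(2::'k::field) \<noteq> 0"
  shows "rigidity_poly (rigid_tensor :: ('k, 'n::finite) tensor3) \<noteq> 0"
proof -
  define d where "d = det (trace_form (rigid_tensor :: ('k, 'n) tensor3))"
  have "d \<noteq> 0" using det_rigid_tensor_trace_form[OF assms] by (simp add: d_def)
  have "krylov_matrix (rigid_tensor :: ('k, 'n) tensor3) $ r $ p = of_bool (r = p) * d ^ Suc (idx p)" for r p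
    by (simp add: krylov_matrix_def rigid_tensor_krylov[OF _ d_def] basis_vec_def axis_def)
  then have "det (krylov_matrix (rigid_tensor :: ('k, 'n) tensor3)) = (\<Prod>p::'n\<in>UNIV. d ^ Suc (idx p))"
    by (subst det_diagonal) simp_all
  then show ?thesis
    using \<open>d \<noteq> 0\<close> by (simp add: rigidity_poly_def d_def[symmetric])
qed

lemma generic_sym_tensor_exists:
  assumes "(2::'k::alg_closed_field) \<noteq> 0"
  shows "\<exists>m::('k, 'n::finite) tensor3. m \<in> sym_tensors \<and> rigidity_poly m \<noteq> 0 \<and> simplicity_poly m \<noteq> 0"
proof -
  have cyclic: "simplicity_poly (cyclic_tensor :: ('k, 'n) tensor3) \<noteq> 0"
    by (simp add: simplicity_poly_cyclic_tensor)
  from tensor_poly_nonzero_on_line[OF infinite_UNIV_alg_closed_field tensor_poly_rigidity_poly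
      tensor_poly_simplicity_poly, OF rigidity_poly_rigid_tensor[OF assms] cyclic]
  obtain t :: 'k where
    "rigidity_poly ((\<lambda>i j l. rigid_tensor i j l + t * (cyclic_tensor i j l - rigid_tensor i j l))
        :: ('k, 'n) tensor3) \<noteq> 0 \<and>
     simplicity_poly ((\<lambda>i j l. rigid_tensor i j l + t * (cyclic_tensor i j l - rigid_tensor i j l))
        :: ('k, 'n) tensor3) \<noteq> 0"
    by blast
  with sym_tensors_line[OF rigid_tensor_sym cyclic_tensor_sym, of t] show ?thesis
    by blast
qed

theorem theorem3:
  assumes "(2::'k::alg_closed_field) \<noteq> 0"
  shows "\<exists>U::('k, 'n::finite) tensor3 set. zariski_open_in sym_tensors U \<and> U \<noteq> {} \<and>
           (\<forall>m\<in>U. alg_simple m \<and> alg_commutative m \<and> trivial_aut_group m)"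
proof -
  let ?U = "{m \<in> sym_tensors. rigidity_poly m * simplicity_poly m \<noteq> 0} :: ('k, 'n) tensor3 set"
  have "zariski_open_in sym_tensors ?U"
    using tensor_poly_mult[OF tensor_poly_rigidity_poly tensor_poly_simplicity_poly]
    by (rule zariski_open_in_nonvanishing)
  moreover have "?U \<noteq> {}"
    using generic_sym_tensor_exists[OF assms] by auto
  moreover have "alg_simple m \<and> alg_commutative m \<and> trivial_aut_group m" if "m \<in> ?U" for m
    using that by (simp add: alg_commutative_if_sym_tensors alg_simple_if_simplicity_poly
        trivial_aut_group_if_rigidity_poly)
  ultimately show ?thesis by blast
qed

end
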